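(* Suppose $K$ is a self-similar set with SSC and $f\in L^1(K,\mu)$. Then $M_{\mathcal{D}}^\mu f\in L^1(K,\mu)$ if and only if $f\in L\log L(K,\mu)$.
   Context: Self-similar set and measure. For $1\le i\le m$ let $S_i:\mathbb{R}^d\to\mathbb{R}^d$, $S_i(x)=r_iR_i(x)+b_i$ with $0<r_i<1$, $b_i\in\mathbb{R}^d$, $R_i$ orthogonal. $K\subset\mathbb{R}^d$ is the unique nonempty compact set with $K=\bigcup_{i=1}^m S_i(K)$ (the self-similar set generated by $\{S_i\}_{i=1}^m$). It is always assumed that the $S_i$ do not all share a common fixed point. Given a probability vector $(p_1,\dots,p_m)$ with all $p_i>0$ and $\sum_i p_i=1$, $\mu$ is the unique Borel probability measure with $\mu=\sum_{i=1}^m p_i\,\mu\circ S_i^{-1}$ (self-similar measure; it is supported on $K$). Strong separation condition (SSC): $S_i(K)\cap S_j(K)=\emptyset$ for all $i\ne j$. Basic cubes. $\Sigma_n=\{1,\dots,m\}^n$ for $n\ge1$. For $\mathbf{i}=i_1\ldots i_n$, $S_{\mathbf{i}}=S_{i_1}\circ\cdots\circ S_{i_n}$ and $K_{\mathbf{i}}=S_{\mathbf{i}}(K)$. $\mathcal{D}$ is the collection consisting of $K$ and all $K_{\mathbf{i}}$, $\mathbf{i}\in\Sigma_n$, $n\ge1$ (basic cubes). Maximal operator. $M_{\mathcal{D}}^\mu f(x)=\sup\frac{1}{\mu(K_{\mathbf{i}})}\int_{K_{\mathbf{i}}}|f|\,d\mu$ for $x\in K$, the supremum being over all $n\in\mathbb{N}=\{1,2,\dots\}$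 and all $\mathbf{i}\in\Sigma_n$ with $x\in K_{\mathbf{i}}$. $L\log L(K,\mu)$ is the family of all $\mu$-measurable functions $f$ on $K$ with $\int_K|f|\log^+|f|\,d\mu<\infty$, where $\log^+t:=\max\{0,\log t\}$ for $t>0$ (and the integrand is $0$ where $f=0$). *)

theory Defs
  imports "HOL-Probability.Probability"
begin

definition sim_map ::
  "(nat \<Rightarrow> real) \<Rightarrow> (nat \<Rightarrow> 'a \<Rightarrow> 'a) \<Rightarrow> (nat \<Rightarrow> 'a) \<Rightarrow> nat \<Rightarrow> 'a \<Rightarrow> 'a::euclidean_space"
  where "sim_map r R b i x = r i *\<^sub>R R i x + b i"

(* The last conjunct also excludes m = 0 and m = 1. *)
definition similarity_system ::
  "nat \<Rightarrow> (nat \<Rightarrow> real) \<Rightarrow> (nat \<Rightarrow> 'a \<Rightarrow> 'a) \<Rightarrow> (nat \<Rightarrow> 'a::euclidean_space) \<Rightarrow> bool"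
  where "similarity_system m r R b \<longleftrightarrow>
    (\<forall>i\<in>{1..m}. 0 < r i \<and> r i < 1 \<and> orthogonal_transformation (R i)) \<and>
    \<not> (\<exists>x. \<forall>i\<in>{1..m}. sim_map r R b i x = x)"

definition self_similar_set :: "nat \<Rightarrow> (nat \<Rightarrow> 'a \<Rightarrow> 'a) \<Rightarrow> 'a::euclidean_space set \<Rightarrow> bool"
  where "self_similar_set m S K \<longleftrightarrow>
    compact K \<and> K \<noteq> {} \<and> K = (\<Union>i\<in>{1..m}. S i ` K)"

definition probability_vector :: "nat \<Rightarrow> (nat \<Rightarrow> real) \<Rightarrow> bool"
  where "probability_vector m p \<longleftrightarrow> (\<forall>i\<in>{1..m}. 0 < p i) \<and> (\<Sum>i=1..m. p i) = 1"

definition self_similar_measure ::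
  "nat \<Rightarrow> (nat \<Rightarrow> 'a \<Rightarrow> 'a) \<Rightarrow> (nat \<Rightarrow> real) \<Rightarrow> 'a::euclidean_space measure \<Rightarrow> bool"
  where "self_similar_measure m S p \<mu> \<longleftrightarrow>
    prob_space \<mu> \<and> sets \<mu> = sets borel \<and>
    (\<forall>A\<in>sets borel. measure \<mu> A = (\<Sum>i=1..m. p i * measure \<mu> (S i -` A)))"

definition strong_separation :: "nat \<Rightarrow> (nat \<Rightarrow> 'a \<Rightarrow> 'a) \<Rightarrow> 'a set \<Rightarrow> bool"
  where "strong_separation m S K \<longleftrightarrow> disjoint_family_on (\<lambda>i. S i ` K) {1..m}"

(* The measure space (K, \<mu>).  Measurability on it is \<mu>-measurability (Borel up to \<mu>-null
   sets), hence the completion. *)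
definition measure_on :: "'a set \<Rightarrow> 'a measure \<Rightarrow> 'a measure"
  where "measure_on K \<mu> = restrict_space (completion \<mu>) K"

definition words :: "nat \<Rightarrow> nat \<Rightarrow> nat list set"
  where "words m n = {w. length w = n \<and> set w \<subseteq> {1..m}}"

definition word_map :: "(nat \<Rightarrow> 'a \<Rightarrow> 'a) \<Rightarrow> nat list \<Rightarrow> 'a \<Rightarrow> 'a"
  where "word_map S w = foldr (\<lambda>i g. S i \<circ> g) w id"

definition basic_cube :: "(nat \<Rightarrow> 'a \<Rightarrow> 'a) \<Rightarrow> 'a set \<Rightarrow> nat list \<Rightarrow> 'a set"
  where "basic_cube S K w = word_map S w ` K"

definition maximal_op ::
  "nat \<Rightarrow> (nat \<Rightarrow> 'a \<Rightarrow> 'a) \<Rightarrow> 'a set \<Rightarrow> 'a measure \<Rightarrow> ('a \<Rightarrow> real) \<Rightarrow> 'a \<Rightarrow> ennreal"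
  where "maximal_op m S K \<mu> f x =
    (SUP w\<in>{w. (\<exists>n\<ge>1. w \<in> words m n) \<and> x \<in> basic_cube S K w}.
      (\<integral>\<^sup>+y\<in>basic_cube S K w. ennreal \<bar>f y\<bar> \<partial>measure_on K \<mu>)
        / emeasure (measure_on K \<mu>) (basic_cube S K w))"

(* Membership in L^1 for functions with values in [0, \<infinity>]; for real-valued functions L^1 is
   the library's integrable. *)
definition L1_nonneg :: "'a measure \<Rightarrow> ('a \<Rightarrow> ennreal) \<Rightarrow> bool"
  where "L1_nonneg N g \<longleftrightarrow> g \<in> borel_measurable N \<and> (\<integral>\<^sup>+x. g x \<partial>N) < \<infinity>"

definition log_plus :: "real \<Rightarrow> real"
  where "log_plus t = max 0 (ln t)"

definition LlogL :: "'a measure \<Rightarrow> ('a \<Rightarrow> real) set"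
  where "LlogL N = {f \<in> borel_measurable N.
    (\<integral>\<^sup>+x. ennreal (\<bar>f x\<bar> * log_plus \<bar>f x\<bar>) \<partial>N) < \<infinity>}"

end

theory Submission
  imports Defs
begin

text \<open>
  For a maximal function along a tree of cubes everything is governed by one picture. Fix a height \<open>t\<close> and,
  on the branch of each point, stop at the first cube whose average of \<open>\<bar>f\<bar>\<close> exceeds \<open>t\<close>. The stopping cubes
  are disjoint and their union is the set where the maximal function exceeds \<open>t\<close>. Averages on stopping cubes
  are larger than \<open>t\<close>; but their parents were not stopping cubes, and a child has at least a fixed proportion
  of the measure of its parent, so they are also at most a constant times \<open>t\<close>, provided that
  \<open>t\<close> is at least the average over the root. Hence the integral of \<open>\<bar>f\<bar>\<close>
  over the level set is comparable to \<open>t\<close> times the measure of the level set (\<open>maximal_weak_type\<close>,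
  \<open>maximal_reverse_weak_type\<close>).

  Taking \<open>t = 2 ^ k\<close> and summing over \<open>k\<close>, the measures of the level sets add up to the integral of the
  maximal function, while the integrals of \<open>\<bar>f\<bar>\<close> count each value \<open>\<bar>f x\<bar>\<close> once for every power of \<open>2\<close>
  below it, that is, about \<open>log\<^sup>+ \<bar>f x\<bar>\<close> times. For the direction from the maximal function to \<open>\<bar>f\<bar> log\<^sup>+ \<bar>f\<bar>\<close>
  one also needs that \<open>\<bar>f\<bar>\<close> is almost everywhere at most its maximal function (\<open>AE_le_maximal\<close>).

  A self-similar set with strong separation is such a tree. Separation and injectivity make the cubes of equal
  generation disjoint, the ratios of similarity make their diameters tend to \<open>0\<close>, and the measure of the cube
  of a word is the product of the probabilities of its letters (\<open>measure_cube\<close>), so the proportion of a child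
  in its parent is at least the smallest probability. The last fact rests on \<open>\<mu>\<close> being carried by \<open>K\<close>
  (\<open>prob_K\<close>), which the self-similarity equation implies.
\<close>

section \<open>Dyadic sums\<close>

lemma ennreal_less_power2:
  fixes c :: ennreal
  assumes "c < top"
  obtains N :: nat where "c < 2 ^ N"
proof -
  obtain r where r: "0 \<le> r" "c = ennreal r"
    using assms by (cases c) auto
  obtain N where "r < 2 ^ N"
    using real_arch_pow[of 2 r] by auto
  then have "ennreal r < ennreal (2 ^ N)"
    using r by (intro ennreal_lessI) auto
  then have "c < 2 ^ N"
    using r by (simp add: ennreal_power[symmetric])
  then show ?thesis by (rule that)
qed

text \<open>
  Integrals of the maximal function are recovered from its level sets at the heights
  \<open>2 ^ k\<close> only. This replaces the layer-cake formula: a geometric sum is comparable to its last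
  term, so up to the additive constant \<open>1\<close> the sum of the powers of \<open>2\<close> below \<open>y\<close> is comparable to \<open>y\<close>, and only countable sums have to
  be exchanged with integrals. The value \<open>\<infinity>\<close> must be covered, as the maximal function may take it;
  the induction therefore runs over the truncations of \<open>y\<close> at \<open>2 ^ N\<close>.
\<close>

lemma le_one_plus_dyadic_sum:
  fixes y :: ennreal
  shows "y \<le> 1 + (\<Sum>k. 2 ^ k * of_bool (2 ^ k < y))" (is "y \<le> ?c")
proof (rule ccontr)
  have part: "min y (2 ^ N) \<le> 1 + (\<Sum>k<N. 2 ^ k * of_bool (2 ^ k < y))" for N
  proof (induction N)
    case 0
    show ?case by simp
  next
    case (Suc N)
    show ?case
    proof (cases "2 ^ N < y")
      case True
      have "min y (2 ^ Suc N) \<le> 2 ^ N + 2 ^ N"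
        by (simp add: mult_2)
      also have "2 ^ N + 2 ^ N = min y (2 ^ N) + 2 ^ N"
        using True by (simp add: min_absorb2)
      also have "\<dots> \<le> 1 + (\<Sum>k<N. 2 ^ k * of_bool (2 ^ k < y)) + 2 ^ N"
        by (intro add_right_mono Suc.IH)
      finally show ?thesis
        using True by (simp add: add.assoc)
    next
      case False
      then have "min y (2 ^ Suc N) \<le> min y (2 ^ N)"
        by (simp add: min.coboundedI1)
      also note Suc.IH
      finally show ?thesis
        using False by simp
    qed
  qed
  assume "\<not> y \<le> ?c"
  then have "?c < y" by simp
  then have "?c < top"
    by (rule less_le_trans) simp
  then obtain N where N: "?c < 2 ^ N"
    by (rule ennreal_less_power2)
  have "min y (2 ^ N) \<le> ?c"
    by (rule order_trans[OF part]) (intro add_left_mono sum_le_suminf; auto)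
  with N \<open>?c < y\<close> show False
    by (auto simp: min_def split: if_splits)
qed

lemma dyadic_sum_le:
  fixes y :: ennreal
  shows "(\<Sum>k. 2 ^ k * of_bool (2 ^ k < y)) \<le> 2 * y"
proof -
  have "(\<Sum>k<N. 2 ^ k * of_bool (2 ^ k < y)) \<le> (2::ennreal) ^ N \<and>
    (\<Sum>k<N. 2 ^ k * of_bool (2 ^ k < y)) \<le> 2 * y" for N
  proof (induction N)
    case (Suc N)
    let ?s = "\<Sum>k<N. (2::ennreal) ^ k * of_bool (2 ^ k < y)"
    from Suc.IH have IH: "?s \<le> 2 ^ N" "?s \<le> 2 * y" by auto
    show ?case
    proof (cases "2 ^ N < y")
      case True
      have le: "?s + 2 ^ N \<le> 2 * 2 ^ N"
        using add_right_mono[OF IH(1), of "2 ^ N"] by (simp add: mult_2)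
      moreover have "(2::ennreal) * 2 ^ N \<le> 2 * y"
        using True by (intro mult_left_mono) auto
      ultimately show ?thesis
        using True by (auto intro: order_trans)
    next
      case False
      have "(2::ennreal) ^ N \<le> 2 ^ Suc N"
        by (rule power_increasing) auto
      with False IH show ?thesis by (auto intro: order_trans)
    qed
  qed auto
  then show ?thesis
    by (simp add: suminf_eq_SUP SUP_least)
qed

text \<open>
  The logarithm enters here: the number of \<open>k\<close> with \<open>2 ^ k < y\<close> is \<open>log\<^sup>+ y\<close> up to constants, because
  \<open>ln 2\<close> lies between \<open>1 / 2\<close> and \<open>1\<close>. The factor \<open>2\<close> in the other bound is the one that the weak type
  inequality produces.
\<close>

lemma log_plus_le_dyadic_count:
  fixes y :: real
  assumes "0 \<le> y"
  shows "ennreal (log_plus y) \<le> (\<Sum>k. of_bool (2 ^ k < ennreal y))"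
proof -
  have part: "log_plus (min y (2 ^ N)) \<le> (\<Sum>k<N. of_bool (2 ^ k < y))" for N
  proof (induction N)
    case 0
    have "ln (min y 1) \<le> 0"
      using assms by (cases "y = 0") (auto intro: ln_le_zero_iff[THEN iffD2])
    then show ?case by (simp add: log_plus_def)
  next
    case (Suc N)
    show ?case
    proof (cases "2 ^ N < y")
      case True
      then have "0 < y" by (smt (verit) zero_less_power)
      have "ln (min y (2 ^ Suc N)) \<le> ln (2 * 2 ^ N)"
        using \<open>0 < y\<close> by (subst ln_le_cancel_iff) auto
      also have "\<dots> = ln 2 + ln (2 ^ N)"
        by (simp add: ln_mult)
      also have "\<dots> \<le> 1 + ln (2 ^ N)"
        using ln_le_minus_one[of "2::real"] by simp
      also have "2 ^ N = min y (2 ^ N)"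
        using True by simp
      finally have "log_plus (min y (2 ^ Suc N)) \<le> 1 + log_plus (min y (2 ^ N))"
        by (auto simp: log_plus_def)
      with True Suc.IH show ?thesis by simp
    next
      case False
      moreover have "(2::real) ^ N \<le> 2 ^ Suc N"
        by (rule power_increasing) auto
      ultimately have "min y (2 ^ Suc N) = min y (2 ^ N)"
        by linarith
      with False Suc.IH show ?thesis by simp
    qed
  qed
  obtain N where N: "y < 2 ^ N"
    using real_arch_pow[of 2 y] by auto
  have eq: "ennreal (of_bool (2 ^ k < y)) = of_bool (2 ^ k < ennreal y)" for k
  proof -
    have "(2 ^ k < ennreal y) \<longleftrightarrow> ennreal (2 ^ k) < ennreal y"
      by (simp add: ennreal_power[symmetric])
    also have "\<dots> \<longleftrightarrow> 2 ^ k < y"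
      by (rule ennreal_less_iff) simp
    finally show ?thesis by simp
  qed
  have "ennreal (log_plus y) \<le> ennreal (\<Sum>k<N. of_bool (2 ^ k < y))"
    using part[of N] N by (intro ennreal_leI) simp
  also have "\<dots> = (\<Sum>k<N. of_bool (2 ^ k < ennreal y))"
    unfolding eq[symmetric] by (rule sum_ennreal[symmetric]) simp
  also have "\<dots> \<le> (\<Sum>k. of_bool (2 ^ k < ennreal y))"
    by (intro sum_le_suminf) auto
  finally show ?thesis .
qed

lemma dyadic_count_le_log_plus:
  fixes y :: real
  assumes "0 \<le> y"
  shows "(\<Sum>k. of_bool (2 ^ k < 2 * ennreal y)) \<le> 2 + 2 * ennreal (log_plus y)"
proof -
  have part: "(\<Sum>k<N. of_bool (2 ^ k < 2 * y)) \<le> 2 + 2 * log_plus y" for N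
  proof (induction N)
    case 0
    show ?case by (simp add: log_plus_def)
  next
    case (Suc N)
    show ?case
    proof (cases "2 ^ N < 2 * y")
      case True
      then have "0 < y" by (smt (verit) zero_less_power)
      have "ln (2 ^ N) < ln (2 * y)"
        using True \<open>0 < y\<close> by (subst ln_less_cancel_iff) auto
      then have "N * ln 2 < ln 2 + ln y"
        using \<open>0 < y\<close> by (simp add: ln_realpow ln_mult)
      moreover have "ln (2::real) > 1 / 2"
        using ln2_ge_two_thirds by simp
      moreover have "ln y \<le> 2 * ln 2 * log_plus y"
      proof -
        have "log_plus y \<le> 2 * ln 2 * log_plus y"
          using ln2_ge_two_thirds mult_right_mono[of 1 "2 * ln 2" "log_plus y"]
          by (auto simp: log_plus_def)
        then show ?thesis by (auto simp: log_plus_def)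
      qed
      ultimately have "N * ln 2 < (1 + 2 * log_plus y) * ln 2"
        by (simp add: algebra_simps)
      then have "N < 1 + 2 * log_plus y"
        by simp
      moreover have "(\<Sum>k<Suc N. of_bool (2 ^ k < 2 * y)) \<le> (\<Sum>k<Suc N. 1::real)"
        by (intro sum_mono) auto
      ultimately show ?thesis by simp
    next
      case False
      with Suc.IH show ?thesis by simp
    qed
  qed
  have eq: "ennreal (of_bool (2 ^ k < 2 * y)) = of_bool (2 ^ k < 2 * ennreal y)" for k
  proof -
    have "(2 ^ k < 2 * ennreal y) \<longleftrightarrow> ennreal (2 ^ k) < ennreal (2 * y)"
      using assms by (simp add: ennreal_power[symmetric] ennreal_mult)
    also have "\<dots> \<longleftrightarrow> 2 ^ k < 2 * y"
      by (rule ennreal_less_iff) simp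
    finally show ?thesis by simp
  qed
  have "(\<Sum>k<N. of_bool (2 ^ k < 2 * ennreal y)) \<le> 2 + 2 * ennreal (log_plus y)" for N
  proof -
    have "(\<Sum>k<N. of_bool (2 ^ k < 2 * ennreal y)) = ennreal (\<Sum>k<N. of_bool (2 ^ k < 2 * y))"
      unfolding eq[symmetric] by (rule sum_ennreal) simp
    also have "\<dots> \<le> ennreal (2 + 2 * log_plus y)"
      by (rule ennreal_leI[OF part])
    also have "\<dots> = 2 + 2 * ennreal (log_plus y)"
      by (simp add: log_plus_def ennreal_mult)
    finally show ?thesis .
  qed
  then show ?thesis
    by (simp add: suminf_eq_SUP SUP_least)
qed

lemma log_plus_nonneg: "0 \<le> log_plus y"
  by (simp add: log_plus_def)

lemma borel_measurable_log_plus [measurable]: "log_plus \<in> borel_measurable borel"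
  unfolding log_plus_def by measurable

lemma ennreal_divide_le_iff:
  fixes a b t :: ennreal
  assumes "0 < b" "b < top"
  shows "a / b \<le> t \<longleftrightarrow> a \<le> t * b"
proof
  assume "a / b \<le> t"
  then have "a / b * b \<le> t * b"
    by (rule mult_right_mono) simp
  then show "a \<le> t * b"
    using assms by (simp add: ennreal_divide_times)
next
  assume "a \<le> t * b"
  then show "a / b \<le> t"
    using assms by (intro divide_le_posI_ennreal) (auto simp: mult.commute)
qed

lemma measurable_of_bool_ennreal [measurable (raw)]:
  "Measurable.pred M P \<Longrightarrow> (\<lambda>x. of_bool (P x) :: ennreal) \<in> borel_measurable M"
  unfolding of_bool_def by measurable

lemma nn_integral_dyadic_sum:
  fixes y :: "'a \<Rightarrow> ennreal"
  assumes [measurable]: "y \<in> borel_measurable M"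
  shows "(\<integral>\<^sup>+x. (\<Sum>k. 2 ^ k * of_bool (2 ^ k < y x)) \<partial>M) =
    (\<Sum>k. 2 ^ k * emeasure M {x \<in> space M. 2 ^ k < y x})"
proof -
  have "(\<integral>\<^sup>+x. 2 ^ k * of_bool (2 ^ k < y x) \<partial>M) = 2 ^ k * emeasure M {x \<in> space M. 2 ^ k < y x}" for k :: nat
  proof -
    have "(\<integral>\<^sup>+x. 2 ^ k * of_bool (2 ^ k < y x) \<partial>M) =
        (\<integral>\<^sup>+x. 2 ^ k * indicator {x \<in> space M. 2 ^ k < y x} x \<partial>M)"
      by (intro nn_integral_cong) (simp add: indicator_def)
    also have "\<dots> = 2 ^ k * emeasure M {x \<in> space M. 2 ^ k < y x}"
      by (rule nn_integral_cmult_indicator) measurable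
    finally show ?thesis .
  qed
  then show ?thesis
    by (subst nn_integral_suminf) simp_all
qed

section \<open>The maximal function of a tree of cubes\<close>

text \<open>
  Words over a countable alphabet index sets that shrink as the word is prolonged. The constant \<open>c\<close> says
  that a child is never much smaller than its parent; this is what makes the weak type inequality
  reversible.
\<close>

locale cube_tree = finite_measure M
  for M :: "'a measure" +
  fixes I :: "'i set" and Q :: "'i list \<Rightarrow> 'a set" and c :: ennreal
  assumes countable_alphabet: "countable I"
    and sets_cube [measurable]: "w \<in> lists I \<Longrightarrow> Q w \<in> sets M"
    and emeasure_cube_pos: "w \<in> lists I \<Longrightarrow> 0 < emeasure M (Q w)"
    and cube_append_subset: "w \<in> lists I \<Longrightarrow> i \<in> I \<Longrightarrow> Q (w @ [i]) \<subseteq> Q w"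
    and cubes_disjoint: "w \<in> lists I \<Longrightarrow> v \<in> lists I \<Longrightarrow> length w = length v \<Longrightarrow> w \<noteq> v \<Longrightarrow>
      Q w \<inter> Q v = {}"
    and ratio_pos: "0 < c" and ratio_finite: "c < top"
    and child_measure: "w \<in> lists I \<Longrightarrow> i \<in> I \<Longrightarrow>
      c * emeasure M (Q w) \<le> emeasure M (Q (w @ [i]))"
begin

definition average :: "('a \<Rightarrow> ennreal) \<Rightarrow> 'i list \<Rightarrow> ennreal"
  where "average g w = (\<integral>\<^sup>+x\<in>Q w. g x \<partial>M) / emeasure M (Q w)"

definition maximal :: "('a \<Rightarrow> ennreal) \<Rightarrow> 'a \<Rightarrow> ennreal"
  where "maximal g x = (SUP w\<in>{w \<in> lists I. w \<noteq> [] \<and> x \<in> Q w}. average g w)"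

text \<open>
  The words at which the averages along a branch exceed \<open>t\<close> for the first time. Their cubes are the maximal
  ones in the level set of the maximal function at height \<open>t\<close>. The empty word is not tested, in accordance
  with the supremum in the maximal function.
\<close>

definition stopping_words :: "('a \<Rightarrow> ennreal) \<Rightarrow> ennreal \<Rightarrow> 'i list set"
  where "stopping_words g t = {w \<in> lists I. w \<noteq> [] \<and> t < average g w \<and>
    (\<forall>n. 0 < n \<longrightarrow> n < length w \<longrightarrow> average g (take n w) \<le> t)}"

lemma countable_words: "countable (lists I)"
  using countable_alphabet by (rule countable_lists)

lemma take_in_lists: "w \<in> lists I \<Longrightarrow> take n w \<in> lists I"
  using set_take_subset[of n w] by (auto simp: in_lists_conv_set)

lemma cube_subset_take:
  assumes "w \<in> lists I"
  shows "Q w \<subseteq> Q (take n w)"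
  using assms
proof (induction w rule: rev_induct)
  case (snoc i w)
  then have w: "w \<in> lists I" "i \<in> I" by auto
  show ?case
  proof (cases "n \<le> length w")
    case True
    then show ?thesis
      using cube_append_subset[OF w] snoc.IH[OF w(1)] by simp
  qed simp
qed simp

lemma intersecting_cubes_prefix:
  assumes "w \<in> lists I" "v \<in> lists I" "Q w \<inter> Q v \<noteq> {}" "length w \<le> length v"
  shows "take (length w) v = w"
  using cube_subset_take[OF assms(2), of "length w"] assms(3,4)
    cubes_disjoint[OF take_in_lists[OF assms(2)] assms(1), of "length w"] by auto

lemma average_le_iff:
  assumes "w \<in> lists I"
  shows "average g w \<le> t \<longleftrightarrow> (\<integral>\<^sup>+x\<in>Q w. g x \<partial>M) \<le> t * emeasure M (Q w)"
proof -
  have "0 < emeasure M (Q w)" "emeasure M (Q w) < top"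
    using assms by (auto simp: emeasure_cube_pos less_top[symmetric])
  then show ?thesis
    unfolding average_def
    by (simp add: ennreal_divide_le_iff)
qed

text \<open>
  If some average along the branch of \<open>x\<close> exceeds \<open>t\<close>, then there is a first one.
\<close>

lemma level_set_eq:
  "{x. t < maximal g x} = (\<Union>w\<in>stopping_words g t. Q w)"
proof (intro set_eqI iffI)
  fix x assume "x \<in> {x. t < maximal g x}"
  then obtain w where w: "w \<in> lists I" "w \<noteq> []" "x \<in> Q w" "t < average g w"
    by (auto simp: maximal_def less_SUP_iff)
  define n where "n = (LEAST n. 0 < n \<and> t < average g (take n w))"
  have ex: "0 < length w \<and> t < average g (take (length w) w)"
    using w by simp
  have n: "0 < n" "t < average g (take n w)" "n \<le> length w"
    using LeastI[of "\<lambda>n. 0 < n \<and> t < average g (take n w)", OF ex]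
      Least_le[of "\<lambda>n. 0 < n \<and> t < average g (take n w)", OF ex]
    by (auto simp: n_def)
  have "average g (take k w) \<le> t" if "0 < k" "k < n" for k
    using not_less_Least[of k "\<lambda>n. 0 < n \<and> t < average g (take n w)"] that
    by (auto simp: n_def)
  then have "take n w \<in> stopping_words g t"
    using n w take_in_lists[OF w(1)] by (auto simp: stopping_words_def min_def)
  moreover have "x \<in> Q (take n w)"
    using cube_subset_take[OF w(1)] w(3) by auto
  ultimately show "x \<in> (\<Union>w\<in>stopping_words g t. Q w)" by blast
next
  fix x assume "x \<in> (\<Union>w\<in>stopping_words g t. Q w)"
  then show "x \<in> {x. t < maximal g x}"
    by (auto simp: stopping_words_def maximal_def less_SUP_iff)
qed

lemma stopping_words_subset: "stopping_words g t \<subseteq> lists I"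
  by (auto simp: stopping_words_def)

text \<open>
  Two cubes that meet belong to comparable words, and a proper prefix of a stopping word is not one.
\<close>

lemma stopping_cubes_disjoint: "disjoint_family_on Q (stopping_words g t)"
proof -
  have *: "length v \<le> length w"
    if "w \<in> stopping_words g t" "v \<in> stopping_words g t" "Q w \<inter> Q v \<noteq> {}" for w v
  proof (rule ccontr)
    assume "\<not> length v \<le> length w"
    with that have "take (length w) v = w"
      by (intro intersecting_cubes_prefix) (auto simp: stopping_words_def)
    moreover have "0 < length w" "length w < length v"
      using that(1) \<open>\<not> length v \<le> length w\<close> by (auto simp: stopping_words_def)
    ultimately have "average g w \<le> t"
      using that(2) unfolding stopping_words_def by force
    with that(1) show False
      by (auto simp: stopping_words_def)
  qed
  show ?thesis
    unfolding disjoint_family_on_def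
  proof (intro ballI impI, rule ccontr)
    fix w v assume wv: "w \<in> stopping_words g t" "v \<in> stopping_words g t" "w \<noteq> v"
      and "Q w \<inter> Q v \<noteq> {}"
    with *[of w v] *[of v w] have "length v = length w"
      by (auto simp: Int_commute)
    moreover have "w \<in> lists I" "v \<in> lists I"
      using wv by (simp_all add: stopping_words_def)
    ultimately show False
      using cubes_disjoint[of w v] \<open>w \<noteq> v\<close> \<open>Q w \<inter> Q v \<noteq> {}\<close> by simp
  qed
qed

lemma sets_level_set [measurable]: "{x. t < maximal g x} \<in> sets M"
  unfolding level_set_eq
proof (rule sets.countable_UN'')
  show "countable (stopping_words g t)"
    using stopping_words_subset countable_words by (rule countable_subset)
  fix w assume "w \<in> stopping_words g t"
  then show "Q w \<in> sets M"
    by (intro sets_cube) (simp add: stopping_words_def)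
qed

lemma level_set_Int_space: "{x \<in> space M. t < maximal g x} = {x. t < maximal g x}"
  using sets.sets_into_space[OF sets_level_set] by auto

lemma borel_measurable_maximal [measurable]: "maximal g \<in> borel_measurable M"
  by (rule borel_measurableI_greater) (simp add: level_set_Int_space sets_level_set)

text \<open>
  A bound between two measures on each cube of a disjoint family passes to the union. With \<open>density M g\<close> as
  one of the measures this turns bounds on averages into bounds on integrals over unions of cubes.
\<close>

lemma emeasure_union_le:
  assumes N: "sets N = sets M" "sets N' = sets M"
    and W: "W \<subseteq> lists I" "disjoint_family_on Q W"
    and le: "\<And>w. w \<in> W \<Longrightarrow> a * emeasure N (Q w) \<le> b * emeasure N' (Q w)"
  shows "a * emeasure N (\<Union>w\<in>W. Q w) \<le> b * emeasure N' (\<Union>w\<in>W. Q w)"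
proof -
  have sets: "w \<in> W \<Longrightarrow> Q w \<in> sets N" "w \<in> W \<Longrightarrow> Q w \<in> sets N'" for w
    unfolding N using W(1) by (auto intro: sets_cube)
  have W': "countable W"
    using W countable_words countable_subset by blast
  have "a * emeasure N (\<Union>w\<in>W. Q w) = (\<integral>\<^sup>+w. a * emeasure N (Q w) \<partial>count_space W)"
    using W W' sets by (simp add: emeasure_UN_countable nn_integral_cmult)
  also have "\<dots> \<le> (\<integral>\<^sup>+w. b * emeasure N' (Q w) \<partial>count_space W)"
    using le by (intro nn_integral_mono) auto
  also have "\<dots> = b * emeasure N' (\<Union>w\<in>W. Q w)"
    using W W' sets by (simp add: emeasure_UN_countable nn_integral_cmult)
  finally show ?thesis .
qed

text \<open>
  Summing the inequality \<open>t < average g w\<close> over the stopping cubes gives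
  \<open>t * \<mu>(A) \<le> \<integral>\<^sub>A g\<close> for the level set \<open>A\<close>. The part of the right-hand side where \<open>g \<le> t / 2\<close> is at most
  half of the left-hand side and is absorbed into it.
\<close>

lemma maximal_weak_type:
  assumes [measurable]: "g \<in> borel_measurable M"
    and "t < top"
  shows "t * emeasure M {x \<in> space M. t < maximal g x} \<le>
    2 * (\<integral>\<^sup>+x. g x * of_bool (t < 2 * g x) \<partial>M)"
proof -
  define A where "A = {x. t < maximal g x}"
  have A_eq: "{x \<in> space M. t < maximal g x} = A"
    by (simp add: A_def level_set_Int_space)
  have A [measurable]: "A \<in> sets M"
    unfolding A_def by (rule sets_level_set)
  have "t * emeasure M (\<Union>w\<in>stopping_words g t. Q w)
      \<le> 1 * emeasure (density M g) (\<Union>w\<in>stopping_words g t. Q w)"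
  proof (rule emeasure_union_le)
    fix w assume "w \<in> stopping_words g t"
    then have "w \<in> lists I" "\<not> average g w \<le> t"
      by (auto simp: stopping_words_def)
    then show "t * emeasure M (Q w) \<le> 1 * emeasure (density M g) (Q w)"
      by (simp add: average_le_iff emeasure_density)
  qed (auto simp: stopping_words_subset stopping_cubes_disjoint)
  then have "t * emeasure M A \<le> (\<integral>\<^sup>+x\<in>A. g x \<partial>M)"
    by (simp add: level_set_eq[symmetric] A_def[symmetric] emeasure_density)
  then have "2 * (t * emeasure M A) \<le> 2 * (\<integral>\<^sup>+x\<in>A. g x \<partial>M)"
    by (intro mult_left_mono) auto
  also have "\<dots> = (\<integral>\<^sup>+x. 2 * (g x * indicator A x) \<partial>M)"
    by (simp add: nn_integral_cmult)
  also have "\<dots> \<le> (\<integral>\<^sup>+x. 2 * (g x * of_bool (t < 2 * g x)) + t * indicator A x \<partial>M)"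
    by (intro nn_integral_mono) (auto simp: indicator_def not_less)
  also have "\<dots> = 2 * (\<integral>\<^sup>+x. g x * of_bool (t < 2 * g x) \<partial>M) + t * emeasure M A"
    by (simp add: nn_integral_add nn_integral_cmult nn_integral_cmult_indicator)
  finally have "t * emeasure M A + t * emeasure M A \<le>
      t * emeasure M A + 2 * (\<integral>\<^sup>+x. g x * of_bool (t < 2 * g x) \<partial>M)"
    by (simp only: mult_2[of "t * emeasure M A"] add.commute)
  \<comment> \<open>The term to be absorbed is finite, so it may be cancelled.\<close>
  moreover have "t * emeasure M A \<noteq> top"
    using assms(2) by (auto simp: ennreal_mult_eq_top_iff)
  ultimately show ?thesis
    by (simp only: A_eq ennreal_add_left_cancel_le) simp
qed

text \<open>
  The parent of a stopping cube has average at most \<open>t\<close>: either it was tested, or it is the root, which is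
  the reason for the lower bound on \<open>t\<close>. As the stopping cube has at least the proportion \<open>c\<close> of the
  measure of its parent, its own average is at most \<open>t / c\<close>.
\<close>

lemma maximal_reverse_weak_type:
  assumes [measurable]: "g \<in> borel_measurable M"
    and t: "average g [] \<le> t"
  shows "c * (\<integral>\<^sup>+x. g x * of_bool (t < maximal g x) \<partial>M) \<le>
    t * emeasure M {x \<in> space M. t < maximal g x}"
proof -
  define A where "A = {x. t < maximal g x}"
  have A_eq: "{x \<in> space M. t < maximal g x} = A"
    by (simp add: A_def level_set_Int_space)
  have A [measurable]: "A \<in> sets M"
    unfolding A_def by (rule sets_level_set)
  have "c * emeasure (density M g) (\<Union>w\<in>stopping_words g t. Q w)
      \<le> t * emeasure M (\<Union>w\<in>stopping_words g t. Q w)"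
  proof (rule emeasure_union_le)
    fix w assume "w \<in> stopping_words g t"
    then have w: "w \<in> lists I" "w \<noteq> []"
      and stop: "\<And>n. 0 < n \<Longrightarrow> n < length w \<Longrightarrow> average g (take n w) \<le> t"
      by (auto simp: stopping_words_def)
    obtain v i where vi: "w = v @ [i]"
      using w(2) by (metis append_butlast_last_id)
    then have v: "v \<in> lists I" "i \<in> I"
      using w(1) by auto
    have "average g v \<le> t"
      using stop[of "length v"] t vi by (cases "v = []") auto
    have "c * (\<integral>\<^sup>+x\<in>Q w. g x \<partial>M) \<le> c * (\<integral>\<^sup>+x\<in>Q v. g x \<partial>M)"
      using cube_append_subset[OF v] unfolding vi
      by (intro mult_left_mono nn_set_integral_set_mono) auto
    also have "\<dots> \<le> c * (t * emeasure M (Q v))"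
      using \<open>average g v \<le> t\<close> by (intro mult_left_mono) (auto simp: average_le_iff[OF v(1)])
    also have "\<dots> \<le> t * emeasure M (Q w)"
      using mult_left_mono[OF child_measure[OF v], of t] by (simp add: vi ac_simps)
    finally show "c * emeasure (density M g) (Q w) \<le> t * emeasure M (Q w)"
      using w(1) by (simp add: emeasure_density)
  qed (auto simp: stopping_words_subset stopping_cubes_disjoint)
  moreover have "g x * of_bool (t < maximal g x) = g x * indicator A x" for x
    by (simp add: A_def indicator_def)
  ultimately show ?thesis
    unfolding A_eq by (simp add: level_set_eq[symmetric] A_def[symmetric] emeasure_density)
qed

text \<open>
  The weak type inequality at the heights \<open>2 ^ k\<close>, summed over \<open>k\<close>: a point \<open>x\<close> contributes \<open>h x\<close> for
  each \<open>k\<close> with \<open>2 ^ k < 2 * h x\<close>, which is about \<open>log\<^sup>+ (h x)\<close> times.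
\<close>

lemma maximal_integrable_if_LlogL:
  fixes h :: "'a \<Rightarrow> real"
  assumes [measurable]: "h \<in> borel_measurable M" and nonneg: "\<And>x. 0 \<le> h x"
    and L1: "(\<integral>\<^sup>+x. h x \<partial>M) < top"
    and LlogL: "(\<integral>\<^sup>+x. ennreal (h x * log_plus (h x)) \<partial>M) < top"
  shows "(\<integral>\<^sup>+x. maximal (\<lambda>x. ennreal (h x)) x \<partial>M) < top"
proof -
  let ?g = "\<lambda>x. ennreal (h x)"
  have max_le: "(\<integral>\<^sup>+x. maximal ?g x \<partial>M) \<le> emeasure M (space M) +
      (\<Sum>k. 2 ^ k * emeasure M {x \<in> space M. 2 ^ k < maximal ?g x})"
  proof -
    have "(\<integral>\<^sup>+x. maximal ?g x \<partial>M) \<le>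
      (\<integral>\<^sup>+x. 1 + (\<Sum>k. 2 ^ k * of_bool (2 ^ k < maximal ?g x)) \<partial>M)"
      by (intro nn_integral_mono le_one_plus_dyadic_sum)
    also have "\<dots> = emeasure M (space M) +
      (\<Sum>k. 2 ^ k * emeasure M {x \<in> space M. 2 ^ k < maximal ?g x})"
      by (subst nn_integral_add) (simp_all add: nn_integral_dyadic_sum)
    finally show ?thesis .
  qed
  have "(\<Sum>k. 2 ^ k * emeasure M {x \<in> space M. 2 ^ k < maximal ?g x}) \<le>
      (\<Sum>k. \<integral>\<^sup>+x. 2 * (?g x * of_bool (2 ^ k < 2 * ?g x)) \<partial>M)"
  proof (intro suminf_le)
    fix k :: nat
    have "(2::ennreal) ^ k < top"
      by (simp add: power_less_top_ennreal)
    then show "2 ^ k * emeasure M {x \<in> space M. 2 ^ k < maximal ?g x} \<le>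
        (\<integral>\<^sup>+x. 2 * (?g x * of_bool (2 ^ k < 2 * ?g x)) \<partial>M)"
      using maximal_weak_type[of ?g "2 ^ k"] by (simp add: nn_integral_cmult)
  qed auto
  also have "\<dots> = (\<integral>\<^sup>+x. (\<Sum>k. 2 * (?g x * of_bool (2 ^ k < 2 * ?g x))) \<partial>M)"
    by (rule nn_integral_suminf[symmetric]) measurable
  also have "\<dots> = (\<integral>\<^sup>+x. 2 * (?g x * (\<Sum>k. of_bool (2 ^ k < 2 * ?g x))) \<partial>M)"
    by (simp only: ennreal_suminf_cmult)
  also have "\<dots> \<le> (\<integral>\<^sup>+x. 2 * (?g x * (2 + 2 * ennreal (log_plus (h x)))) \<partial>M)"
    by (intro nn_integral_mono mult_left_mono dyadic_count_le_log_plus nonneg) auto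
  also have "\<dots> = (\<integral>\<^sup>+x. 4 * ?g x + 4 * ennreal (h x * log_plus (h x)) \<partial>M)"
    by (intro nn_integral_cong) (simp add: nonneg ennreal_mult log_plus_nonneg algebra_simps)
  also have "\<dots> = 4 * (\<integral>\<^sup>+x. ?g x \<partial>M) + 4 * (\<integral>\<^sup>+x. ennreal (h x * log_plus (h x)) \<partial>M)"
    by (simp add: nn_integral_add nn_integral_cmult)
  also have "\<dots> < top"
    using L1 LlogL by (simp add: ennreal_mult_less_top)
  finally show ?thesis
    by (intro le_less_trans[OF max_le]) (simp add: less_top[symmetric])
qed

text \<open>
  The same computation backwards. Up to a null set, \<open>{2 ^ k < h}\<close> is contained in the level set of the
  maximal function, to which the reverse inequality applies as soon as \<open>2 ^ k\<close> exceeds the average over the root.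
  The finitely many smaller \<open>k\<close> are paid for by \<open>\<integral>h\<close>.
\<close>

lemma LlogL_if_maximal_integrable:
  fixes h :: "'a \<Rightarrow> real"
  assumes [measurable]: "h \<in> borel_measurable M" and nonneg: "\<And>x. 0 \<le> h x"
    and le: "AE x in M. ennreal (h x) \<le> maximal (\<lambda>x. ennreal (h x)) x"
    and L1: "(\<integral>\<^sup>+x. h x \<partial>M) < top"
    and max: "(\<integral>\<^sup>+x. maximal (\<lambda>x. ennreal (h x)) x \<partial>M) < top"
  shows "(\<integral>\<^sup>+x. ennreal (h x * log_plus (h x)) \<partial>M) < top"
proof -
  let ?g = "\<lambda>x. ennreal (h x)"
  have "average ?g [] < top"
  proof -
    have "(\<integral>\<^sup>+x\<in>Q []. ?g x \<partial>M) \<le> (\<integral>\<^sup>+x. ?g x \<partial>M)"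
      by (intro nn_integral_mono) (auto simp: indicator_def)
    then show ?thesis
      using L1 emeasure_cube_pos[of "[]"]
      by (auto simp: average_def ennreal_divide_eq_top_iff less_top[symmetric] top_unique)
  qed
  then obtain k0 where k0: "average ?g [] < 2 ^ k0"
    by (rule ennreal_less_power2)
  let ?A = "\<lambda>k. emeasure M {x \<in> space M. 2 ^ k < maximal ?g x}"
  have layer: "c * (\<integral>\<^sup>+x. ?g x * of_bool (2 ^ k < ?g x) \<partial>M) \<le>
      c * (\<integral>\<^sup>+x. ?g x \<partial>M) * of_bool (k < k0) + 2 ^ k * ?A k" for k
  proof (cases "k < k0")
    case True
    have "(\<integral>\<^sup>+x. ?g x * of_bool (2 ^ k < ?g x) \<partial>M) \<le> (\<integral>\<^sup>+x. ?g x \<partial>M)"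
      by (intro nn_integral_mono) auto
    with True show ?thesis
      by (simp add: mult_left_mono add_increasing2)
  next
    case False
    have "(2::ennreal) ^ k0 \<le> 2 ^ k"
      using False by (intro power_increasing) auto
    then have avg: "average ?g [] \<le> 2 ^ k"
      using k0 by auto
    have "(\<integral>\<^sup>+x. ?g x * of_bool (2 ^ k < ?g x) \<partial>M) \<le>
        (\<integral>\<^sup>+x. ?g x * of_bool (2 ^ k < maximal ?g x) \<partial>M)"
      using le by (intro nn_integral_mono_AE) (auto elim!: eventually_mono)
    then have "c * (\<integral>\<^sup>+x. ?g x * of_bool (2 ^ k < ?g x) \<partial>M) \<le> 2 ^ k * ?A k"
      by (rule order_trans[OF mult_left_mono maximal_reverse_weak_type[OF _ avg]]) auto
    with False show ?thesis by simp
  qed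
  have "(\<integral>\<^sup>+x. ennreal (h x * log_plus (h x)) \<partial>M) \<le>
      (\<integral>\<^sup>+x. ?g x * (\<Sum>k. of_bool (2 ^ k < ?g x)) \<partial>M)"
    by (intro nn_integral_mono)
      (simp add: nonneg ennreal_mult log_plus_nonneg mult_left_mono log_plus_le_dyadic_count)
  also have "\<dots> = (\<integral>\<^sup>+x. (\<Sum>k. ?g x * of_bool (2 ^ k < ?g x)) \<partial>M)"
    by (simp only: ennreal_suminf_cmult)
  also have "\<dots> = (\<Sum>k. \<integral>\<^sup>+x. ?g x * of_bool (2 ^ k < ?g x) \<partial>M)"
    by (rule nn_integral_suminf) measurable
  finally have "c * (\<integral>\<^sup>+x. ennreal (h x * log_plus (h x)) \<partial>M) \<le>
      c * (\<Sum>k. \<integral>\<^sup>+x. ?g x * of_bool (2 ^ k < ?g x) \<partial>M)"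
    by (rule mult_left_mono) simp
  also have "\<dots> = (\<Sum>k. c * (\<integral>\<^sup>+x. ?g x * of_bool (2 ^ k < ?g x) \<partial>M))"
    by (rule ennreal_suminf_cmult[symmetric])
  also have "\<dots> \<le> (\<Sum>k. c * (\<integral>\<^sup>+x. ?g x \<partial>M) * of_bool (k < k0) + 2 ^ k * ?A k)"
    by (intro suminf_le layer) auto
  also have "\<dots> = c * (\<integral>\<^sup>+x. ?g x \<partial>M) * (\<Sum>k. of_bool (k < k0)) + (\<Sum>k. 2 ^ k * ?A k)"
    by (subst suminf_add[symmetric]) (auto simp: ennreal_suminf_cmult)
  also have "(\<Sum>k. of_bool (k < k0)) = (of_nat k0 :: ennreal)"
    by (subst suminf_finite[of "{..<k0}"]) auto
  also have "(\<Sum>k. 2 ^ k * ?A k) = (\<integral>\<^sup>+x. (\<Sum>k. 2 ^ k * of_bool (2 ^ k < maximal ?g x)) \<partial>M)"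
    by (rule nn_integral_dyadic_sum[symmetric]) measurable
  finally have le_dyadic: "c * (\<integral>\<^sup>+x. ennreal (h x * log_plus (h x)) \<partial>M) \<le>
      c * (\<integral>\<^sup>+x. ?g x \<partial>M) * of_nat k0 +
      (\<integral>\<^sup>+x. (\<Sum>k. 2 ^ k * of_bool (2 ^ k < maximal ?g x)) \<partial>M)" .
  have "(\<integral>\<^sup>+x. (\<Sum>k. 2 ^ k * of_bool (2 ^ k < maximal ?g x)) \<partial>M) \<le>
      (\<integral>\<^sup>+x. 2 * maximal ?g x \<partial>M)"
    by (intro nn_integral_mono dyadic_sum_le)
  also have "\<dots> < top"
    using max by (simp add: nn_integral_cmult ennreal_mult_less_top)
  finally have "(\<integral>\<^sup>+x. (\<Sum>k. 2 ^ k * of_bool (2 ^ k < maximal ?g x)) \<partial>M) < top" .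
  then have "c * (\<integral>\<^sup>+x. ennreal (h x * log_plus (h x)) \<partial>M) < top"
    using L1 ratio_finite by (intro le_less_trans[OF le_dyadic]) (simp add: ennreal_mult_less_top of_nat_less_top)
  then show ?thesis
    using ratio_pos by (auto simp: ennreal_mult_less_top)
qed

end

section \<open>Differentiation along shrinking cubes\<close>

lemma emeasure_closed_neighbourhoods_tendsto:
  fixes M :: "'a::metric_space measure" and \<delta> :: "nat \<Rightarrow> real"
  assumes "finite_measure M" and sets: "sets M = sets borel"
    and "closed E" "E \<noteq> {}" and "decseq \<delta>" "\<delta> \<longlonglongrightarrow> 0"
  shows "(\<lambda>n. emeasure M {x. infdist x E \<le> \<delta> n}) \<longlonglongrightarrow> emeasure M E"
proof -
  interpret finite_measure M by fact
  let ?N = "\<lambda>n. {x. infdist x E \<le> \<delta> n}"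
  have closed: "closed (?N n)" for n
    by (intro closed_Collect_le continuous_intros)
  have "0 \<le> \<delta> n" for n
    using decseq_ge[OF \<open>decseq \<delta>\<close> \<open>\<delta> \<longlonglongrightarrow> 0\<close>] .
  have "(\<Inter>n. ?N n) = E"
  proof (intro equalityI subsetI)
    fix x assume "x \<in> (\<Inter>n. ?N n)"
    then have "infdist x E \<le> 0"
      by (intro LIMSEQ_le_const[OF \<open>\<delta> \<longlonglongrightarrow> 0\<close>]) auto
    then have "infdist x E = 0"
      using infdist_nonneg[of x E] by linarith
    then show "x \<in> E"
      using in_closed_iff_infdist_zero[OF \<open>closed E\<close> \<open>E \<noteq> {}\<close>] by simp
  next
    fix x assume "x \<in> E"
    then show "x \<in> (\<Inter>n. ?N n)"
      using \<open>\<And>n. 0 \<le> \<delta> n\<close> by simp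
  qed
  moreover have "(\<lambda>n. emeasure M (?N n)) \<longlonglongrightarrow> emeasure M (\<Inter>n. ?N n)"
  proof (rule Lim_emeasure_decseq)
    show "range ?N \<subseteq> sets M"
      using closed by (auto simp: sets)
    show "decseq ?N"
      using \<open>decseq \<delta>\<close> by (auto simp: decseq_def intro: order_trans)
  qed simp
  ultimately show ?thesis by simp
qed

locale shrinking_cube_tree = cube_tree M I Q c
  for M :: "'a::euclidean_space measure" and I :: "'i set" and Q c +
  fixes \<delta> :: "nat \<Rightarrow> real"
  assumes sets_borel: "sets M = sets borel"
    and cubes_cover: "x \<in> Q [] \<Longrightarrow> \<exists>w\<in>lists I. length w = n \<and> x \<in> Q w"
    and cube_diameter: "w \<in> lists I \<Longrightarrow> x \<in> Q w \<Longrightarrow> y \<in> Q w \<Longrightarrow> dist x y \<le> \<delta> (length w)"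
    and \<delta>_decseq: "decseq \<delta>" and \<delta>_tendsto: "\<delta> \<longlonglongrightarrow> 0"
begin

text \<open>
  Cover the compact set \<open>E\<close> by the cubes of generation \<open>n\<close> that meet it. Each of them contains a point
  where the maximal function is at most \<open>a\<close>, so the average over it is at most \<open>a\<close>; the union of these
  cubes shrinks to \<open>E\<close> as \<open>n\<close> grows.
\<close>

lemma density_le_on_sublevel_compact:
  assumes g [measurable]: "g \<in> borel_measurable M"
    and E: "compact E" "E \<subseteq> Q []" "\<And>x. x \<in> E \<Longrightarrow> maximal g x \<le> a"
    and "a < top"
  shows "emeasure (density M g) E \<le> a * emeasure M E"
proof (cases "E = {}")
  case False
  have closed: "closed E"
    using E(1) by (rule compact_imp_closed)
  \<comment> \<open>Generation \<open>Suc n\<close> rather than \<open>n\<close>: the root does not take part in the maximal function.\<close>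
  let ?N = "\<lambda>n. {x. infdist x E \<le> \<delta> (Suc n)}"
  have "emeasure (density M g) E \<le> a * emeasure M (?N n)" for n
  proof -
    define W where "W = {w \<in> lists I. length w = Suc n \<and> Q w \<inter> E \<noteq> {}}"
    have W: "W \<subseteq> lists I"
      by (auto simp: W_def)
    have UN: "(\<Union>w\<in>W. Q w) \<in> sets M"
      using W by (intro sets.countable_UN'' countable_subset[OF W countable_words] sets_cube) auto
    have "E \<subseteq> (\<Union>w\<in>W. Q w)"
    proof
      fix x assume "x \<in> E"
      then obtain w where "w \<in> lists I" "length w = Suc n" "x \<in> Q w"
        using E(2) cubes_cover[of x "Suc n"] by auto
      with \<open>x \<in> E\<close> show "x \<in> (\<Union>w\<in>W. Q w)"
        by (auto simp: W_def)
    qed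
    then have "emeasure (density M g) E \<le> emeasure (density M g) (\<Union>w\<in>W. Q w)"
      using UN by (intro emeasure_mono) auto
    also have "1 * \<dots> \<le> a * emeasure M (\<Union>w\<in>W. Q w)"
    proof (rule emeasure_union_le)
      show "disjoint_family_on Q W"
        using cubes_disjoint by (auto simp: disjoint_family_on_def W_def)
      fix w assume "w \<in> W"
      then obtain x where w: "w \<in> lists I" "length w = Suc n" and x: "x \<in> Q w" "x \<in> E"
        by (auto simp: W_def)
      then have "average g w \<le> maximal g x"
        unfolding maximal_def by (intro SUP_upper) auto
      also have "\<dots> \<le> a"
        using x E(3) by simp
      finally show "1 * emeasure (density M g) (Q w) \<le> a * emeasure M (Q w)"
        using w by (simp add: average_le_iff emeasure_density)
    qed (auto simp: W)
    also have "\<dots> \<le> a * emeasure M (?N n)"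
    proof (intro mult_left_mono emeasure_mono subsetI)
      fix y assume "y \<in> (\<Union>w\<in>W. Q w)"
      then obtain w x where "w \<in> lists I" "length w = Suc n" "y \<in> Q w" "x \<in> Q w" "x \<in> E"
        by (auto simp: W_def)
      then have "dist y x \<le> \<delta> (Suc n)"
        using cube_diameter[of w y x] by simp
      then show "y \<in> ?N n"
        using infdist_le[OF \<open>x \<in> E\<close>, of y] by simp
    next
      have "closed (?N n)"
        by (intro closed_Collect_le continuous_intros)
      then show "?N n \<in> sets M"
        by (simp add: sets_borel)
    qed simp
    finally show ?thesis by simp
  qed
  moreover have "(\<lambda>n. a * emeasure M (?N n)) \<longlonglongrightarrow> a * emeasure M E"
    using LIMSEQ_Suc[OF emeasure_closed_neighbourhoods_tendsto[OF finite_measure_axioms sets_borel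
          closed False \<delta>_decseq \<delta>_tendsto]] \<open>a < top\<close>
    by (intro ennreal_tendsto_cmult)
  ultimately show ?thesis
    by (intro LIMSEQ_le_const) auto
qed simp

text \<open>
  The half of Lebesgue's differentiation theorem by which level sets of \<open>g\<close> can be enlarged to level sets
  of the maximal function. No covering lemma or
  convergence of averages enters: for \<open>a < b\<close> the set where the maximal function is at most \<open>a\<close> but
  \<open>g\<close> at least \<open>b\<close> has no compact subset of positive measure, because on such a subset the integral of
  \<open>g\<close> would be both at least \<open>b\<close> and at most \<open>a\<close> times the measure. Inner regularity does the rest.
\<close>

lemma AE_le_maximal:
  assumes g [measurable]: "g \<in> borel_measurable M"
  shows "AE x in M. x \<in> Q [] \<longrightarrow> g x \<le> maximal g x"
proof -
  define B where "B a b = {x \<in> Q []. maximal g x \<le> a \<and> b \<le> g x}" for a b :: ennreal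
  have null: "B a b \<in> null_sets M" if "a < b" for a b
  proof -
    have space: "space M = UNIV"
      using sets_eq_imp_space_eq[OF sets_borel] by simp
    have B: "B a b \<in> sets M"
    proof -
      have "B a b = Q [] \<inter> {x \<in> space M. maximal g x \<le> a \<and> b \<le> g x}"
        by (auto simp: B_def space)
      also have "\<dots> \<in> sets M"
        by (intro sets.Int sets_cube) (simp, measurable)
      finally show ?thesis .
    qed
    have compact_null: "emeasure M C = 0" if C: "C \<subseteq> B a b" "compact C" for C
    proof (rule ccontr)
      have C_sets: "C \<in> sets M"
        using C(2) by (simp add: sets_borel borel_compact)
      assume "emeasure M C \<noteq> 0"
      have "b * emeasure M C = (\<integral>\<^sup>+x\<in>C. b \<partial>M)"
        using C_sets by (simp add: nn_integral_cmult_indicator)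
      also have "\<dots> \<le> (\<integral>\<^sup>+x\<in>C. g x \<partial>M)"
        using C(1) by (intro nn_integral_mono) (auto simp: B_def indicator_def)
      also have "\<dots> = emeasure (density M g) C"
        using C_sets by (simp add: emeasure_density)
      also have "\<dots> \<le> a * emeasure M C"
      proof (rule density_le_on_sublevel_compact)
        show "a < top"
          using \<open>a < b\<close> by (rule less_le_trans) simp
      qed (use C in \<open>auto simp: B_def\<close>)
      finally have "b \<le> a"
        using \<open>emeasure M C \<noteq> 0\<close> ennreal_mult_le_mult_iff[of "emeasure M C" b a]
        by (simp add: mult.commute)
      with \<open>a < b\<close> show False by simp
    qed
    have "emeasure M (B a b) = (SUP C\<in>{C. C \<subseteq> B a b \<and> compact C}. emeasure M C)"
      using B by (intro inner_regular) (auto simp: sets_borel)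
    also have "\<dots> \<le> 0"
      using compact_null by (intro SUP_least) auto
    finally have "emeasure M (B a b) = 0"
      by simp
    with B show ?thesis by (simp add: null_sets_def)
  qed
  define A where "A = {(q, s). ennreal (real_of_rat q) < ennreal (real_of_rat s)}"
  have "(\<Union>(q, s)\<in>A. B (real_of_rat q) (real_of_rat s)) \<in> null_sets M"
    by (intro null_sets_UN') (auto simp: A_def null)
  moreover have "{x \<in> space M. \<not> (x \<in> Q [] \<longrightarrow> g x \<le> maximal g x)} \<subseteq>
      (\<Union>(q, s)\<in>A. B (real_of_rat q) (real_of_rat s))"
  proof
    fix x assume "x \<in> {x \<in> space M. \<not> (x \<in> Q [] \<longrightarrow> g x \<le> maximal g x)}"
    then have x: "x \<in> Q []" "maximal g x < g x"
      by auto
    obtain q where q: "maximal g x < real_of_rat q" "real_of_rat q < g x"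
      using ennreal_rat_dense[OF x(2)] by auto
    obtain s where s: "real_of_rat q < ennreal (real_of_rat s)" "real_of_rat s < g x"
      using ennreal_rat_dense[OF q(2)] by auto
    have "(q, s) \<in> A" "x \<in> B (real_of_rat q) (real_of_rat s)"
      using x q s by (auto simp: A_def B_def)
    then show "x \<in> (\<Union>(q, s)\<in>A. B (real_of_rat q) (real_of_rat s))"
      by blast
  qed
  ultimately show ?thesis
    by (rule AE_I')
qed

lemma maximal_integrable_iff_LlogL:
  fixes h :: "'a \<Rightarrow> real"
  assumes [measurable]: "h \<in> borel_measurable M" and nonneg: "\<And>x. 0 \<le> h x"
    and outside: "\<And>x. x \<notin> Q [] \<Longrightarrow> h x = 0"
    and L1: "(\<integral>\<^sup>+x. h x \<partial>M) < top"
  shows "(\<integral>\<^sup>+x. maximal (\<lambda>x. ennreal (h x)) x \<partial>M) < top \<longleftrightarrow>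
    (\<integral>\<^sup>+x. ennreal (h x * log_plus (h x)) \<partial>M) < top"
proof -
  have "AE x in M. ennreal (h x) \<le> maximal (\<lambda>x. ennreal (h x)) x"
    using AE_le_maximal[of "\<lambda>x. ennreal (h x)"]
    by (auto elim!: eventually_mono) (metis ennreal_0 outside zero_le)
  then show ?thesis
    using maximal_integrable_if_LlogL[OF assms(1,2,4)] LlogL_if_maximal_integrable[OF assms(1,2) _ L1]
    by blast
qed

end

section \<open>Self-similar sets with strong separation\<close>

locale separated_self_similar =
  fixes m :: nat and r p :: "nat \<Rightarrow> real" and R :: "nat \<Rightarrow> 'a::euclidean_space \<Rightarrow> 'a"
    and b :: "nat \<Rightarrow> 'a" and K :: "'a set" and \<mu> :: "'a measure"
  assumes system: "similarity_system m r R b"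
    and K: "self_similar_set m (sim_map r R b) K"
    and p: "probability_vector m p"
    and \<mu>: "self_similar_measure m (sim_map r R b) p \<mu>"
    and separation: "strong_separation m (sim_map r R b) K"
begin

abbreviation S :: "nat \<Rightarrow> 'a \<Rightarrow> 'a" where "S \<equiv> sim_map r R b"
abbreviation cube :: "nat list \<Rightarrow> 'a set" where "cube \<equiv> basic_cube S K"

sublocale prob_space \<mu>
  using \<mu> by (simp add: self_similar_measure_def)

lemma sets_\<mu> [measurable_cong]: "sets \<mu> = sets borel"
  using \<mu> by (simp add: self_similar_measure_def)

lemma space_\<mu>: "space \<mu> = UNIV"
  using sets_eq_imp_space_eq[OF sets_\<mu>] by simp

lemma measure_self_similar:
  "A \<in> sets borel \<Longrightarrow> measure \<mu> A = (\<Sum>i=1..m. p i * measure \<mu> (S i -` A))"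
  using \<mu> by (simp add: self_similar_measure_def)

lemma compact_K: "compact K" and K_nonempty: "K \<noteq> {}"
  using K by (auto simp: self_similar_set_def)

lemma S_in_K: "i \<in> {1..m} \<Longrightarrow> x \<in> K \<Longrightarrow> S i x \<in> K"
  using K unfolding self_similar_set_def by blast

lemma K_cases:
  assumes "x \<in> K"
  obtains i y where "i \<in> {1..m}" "y \<in> K" "x = S i y"
  using K assms unfolding self_similar_set_def by blast

lemma p_pos: "i \<in> {1..m} \<Longrightarrow> 0 < p i" and p_sum: "(\<Sum>i=1..m. p i) = 1"
  using p by (auto simp: probability_vector_def)

lemma m_pos: "0 < m"
  using p_sum by (cases m) auto

lemma r_bounds: "i \<in> {1..m} \<Longrightarrow> 0 < r i" "i \<in> {1..m} \<Longrightarrow> r i < 1"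
  using system by (auto simp: similarity_system_def)

lemma dist_S:
  assumes "i \<in> {1..m}"
  shows "dist (S i x) (S i y) = r i * dist x y"
proof -
  have R: "orthogonal_transformation (R i)" and "0 < r i"
    using system assms by (auto simp: similarity_system_def)
  have "S i x - S i y = r i *\<^sub>R R i (x - y)"
    using R by (simp add: sim_map_def orthogonal_transformation_linear linear_diff scaleR_diff_right)
  then show ?thesis
    using \<open>0 < r i\<close> orthogonal_transformation_norm[OF R, of "x - y"] by (simp add: dist_norm)
qed

lemma inj_S: "i \<in> {1..m} \<Longrightarrow> inj (S i)"
  using r_bounds(1) by (intro injI) (metis dist_S dist_eq_0_iff mult_eq_0_iff less_irrefl)

lemma continuous_on_S:
  assumes "i \<in> {1..m}"
  shows "continuous_on A (S i)"
proof -
  have "(r i)-lipschitz_on A (S i)"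
    using dist_S[OF assms] r_bounds(1)[OF assms] by (intro lipschitz_onI) auto
  then show ?thesis
    by (rule lipschitz_on_continuous_on)
qed

lemma measurable_S: "i \<in> {1..m} \<Longrightarrow> S i \<in> borel_measurable borel"
  by (intro borel_measurable_continuous_onI continuous_on_S)

lemma cube_simps: "cube [] = K" "cube (i # w) = S i ` cube w"
  by (auto simp: basic_cube_def word_map_def)

lemma cube_subset_K:
  "w \<in> lists {1..m} \<Longrightarrow> cube w \<subseteq> K"
proof (induction w)
  case (Cons i w)
  then have "S i ` cube w \<subseteq> S i ` K"
    by auto
  also have "\<dots> \<subseteq> K"
    using S_in_K Cons.prems by auto
  finally show ?case by (simp add: cube_simps)
qed (simp add: cube_simps)

lemma compact_cube: "w \<in> lists {1..m} \<Longrightarrow> compact (cube w)"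
  by (induction w)
    (auto simp: cube_simps compact_K intro!: compact_continuous_image continuous_on_S)

lemma cube_append:
  assumes "w \<in> lists {1..m}" "i \<in> {1..m}"
  shows "cube (w @ [i]) \<subseteq> cube w"
  using assms(1)
proof (induction w)
  case Nil
  show ?case
    using cube_subset_K[of "[i]"] assms(2) by (simp add: cube_simps)
next
  case (Cons j w)
  then show ?case
    by (auto simp: cube_simps)
qed

lemma cubes_same_length_disjoint:
  assumes "w \<in> lists {1..m}" "v \<in> lists {1..m}" "length w = length v" "w \<noteq> v"
  shows "cube w \<inter> cube v = {}"
  using assms(3,1,2,4)
proof (induction w v rule: list_induct2)
  case (Cons i w j v)
  then have ij: "i \<in> {1..m}" "j \<in> {1..m}" and wv: "w \<in> lists {1..m}" "v \<in> lists {1..m}"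
    by auto
  show ?case
  proof (cases "i = j")
    case True
    with Cons wv have "cube w \<inter> cube v = {}"
      by auto
    with True show ?thesis
      using image_Int[OF inj_S[OF ij(1)], of "cube w" "cube v"] by (simp add: cube_simps)
  next
    case False
    then have "S i ` K \<inter> S j ` K = {}"
      using separation ij by (auto simp: strong_separation_def disjoint_family_on_def)
    moreover have "cube (i # w) \<subseteq> S i ` K" "cube (j # v) \<subseteq> S j ` K"
      using cube_subset_K[OF wv(1)] cube_subset_K[OF wv(2)] by (auto simp: cube_simps)
    ultimately show ?thesis by blast
  qed
qed simp

lemma cubes_cover_K:
  "x \<in> K \<Longrightarrow> \<exists>w\<in>lists {1..m}. length w = n \<and> x \<in> cube w"
proof (induction n arbitrary: x)
  case 0
  then show ?case
    by (intro bexI[of _ "[]"]) (auto simp: cube_simps)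
next
  case (Suc n)
  from Suc.prems obtain i y where i: "i \<in> {1..m}" "y \<in> K" "x = S i y"
    by (rule K_cases)
  then obtain w where "w \<in> lists {1..m}" "length w = n" "y \<in> cube w"
    using Suc.IH by blast
  with i show ?case
    by (intro bexI[of _ "i # w"]) (auto simp: cube_simps)
qed

definition ratio :: real
  where "ratio = Max (r ` {1..m})"

definition weight :: real
  where "weight = Min (p ` {1..m})"

lemma ratio: "0 < ratio" "ratio < 1" "i \<in> {1..m} \<Longrightarrow> r i \<le> ratio"
proof -
  have *: "finite (r ` {1..m})" "r ` {1..m} \<noteq> {}"
    using m_pos by auto
  from Max_in[OF *] r_bounds show "0 < ratio" "ratio < 1"
    by (auto simp: ratio_def)
  show "r i \<le> ratio" if "i \<in> {1..m}"
    unfolding ratio_def using that by (intro Max_ge) auto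
qed

lemma weight: "0 < weight" "i \<in> {1..m} \<Longrightarrow> weight \<le> p i"
proof -
  have *: "finite (p ` {1..m})" "p ` {1..m} \<noteq> {}"
    using m_pos by auto
  from Min_in[OF *] p_pos show "0 < weight"
    by (auto simp: weight_def)
  show "weight \<le> p i" if "i \<in> {1..m}"
    unfolding weight_def using that by (intro Min_le) auto
qed

lemma dist_cube_le:
  "w \<in> lists {1..m} \<Longrightarrow> x \<in> cube w \<Longrightarrow> y \<in> cube w \<Longrightarrow> dist x y \<le> ratio ^ length w * diameter K"
proof (induction w arbitrary: x y)
  case Nil
  then show ?case
    using diameter_bounded_bound[OF compact_imp_bounded[OF compact_K]] by (simp add: cube_simps)
next
  case (Cons i w)
  then obtain x' y' where xy: "x' \<in> cube w" "y' \<in> cube w" "x = S i x'" "y = S i y'"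
    and i: "i \<in> {1..m}"
    by (auto simp: cube_simps)
  have "dist x y = r i * dist x' y'"
    using dist_S[OF i] xy by simp
  also have "\<dots> \<le> ratio * (ratio ^ length w * diameter K)"
    using Cons xy i ratio r_bounds(1)[OF i] by (intro mult_mono) auto
  finally show ?case by simp
qed

text \<open>
  The measure is invariant under a random contraction towards \<open>K\<close>: each \<open>S i\<close> maps the neighbourhood of
  radius \<open>e / ratio\<close> into that of radius \<open>e\<close>, so the larger one has no more mass than the smaller one.
  By iteration, neighbourhoods that exhaust the space have no more mass than the one of radius \<open>e\<close>.
\<close>

lemma measure_neighbourhood_K:
  assumes "0 < e"
  shows "measure \<mu> {x. infdist x K \<le> e} = 1"
proof -
  let ?N = "\<lambda>e. {x. infdist x K \<le> e}"
  have closed: "closed (?N e)" for e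
    by (intro closed_Collect_le continuous_intros)
  have step: "measure \<mu> (?N (e / ratio)) \<le> measure \<mu> (?N e)" for e
  proof -
    have "?N (e / ratio) \<subseteq> S i -` ?N e" if i: "i \<in> {1..m}" for i
    proof
      fix x assume x: "x \<in> ?N (e / ratio)"
      obtain y where y: "y \<in> K" "infdist x K = dist x y"
        using infdist_attains_inf[OF compact_imp_closed[OF compact_K] K_nonempty] .
      have "S i y \<in> K"
        using i y(1) by (rule S_in_K)
      then have "infdist (S i x) K \<le> dist (S i x) (S i y)"
        by (rule infdist_le)
      also have "\<dots> = r i * dist x y"
        by (rule dist_S[OF i])
      also have "\<dots> \<le> ratio * (e / ratio)"
        using x y(2) ratio(1) ratio(3)[OF i] by (intro mult_mono) auto
      finally show "x \<in> S i -` ?N e"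
        using ratio(1) by simp
    qed
    then have "(\<Sum>i=1..m. p i * measure \<mu> (?N (e / ratio))) \<le> (\<Sum>i=1..m. p i * measure \<mu> (S i -` ?N e))"
      using p_pos closed measurable_sets[OF measurable_S, of _ "?N e"]
      by (intro sum_mono mult_left_mono finite_measure_mono) (auto simp: sets_\<mu> less_imp_le)
    then show ?thesis
      using measure_self_similar[of "?N e"] closed p_sum by (simp flip: sum_distrib_right)
  qed
  have le: "measure \<mu> (?N (e / ratio ^ n)) \<le> measure \<mu> (?N e)" for n
  proof (induction n)
    case (Suc n)
    have "measure \<mu> (?N (e / ratio ^ Suc n)) \<le> measure \<mu> (?N (e / ratio ^ n))"
      using step[of "e / ratio ^ n"] by (simp add: mult.commute)
    with Suc show ?case by simp
  qed simp
  have "(\<lambda>n. measure \<mu> (?N (e / ratio ^ n))) \<longlonglongrightarrow> measure \<mu> (\<Union>n. ?N (e / ratio ^ n))"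
  proof (rule finite_Lim_measure_incseq)
    show "range (\<lambda>n. ?N (e / ratio ^ n)) \<subseteq> sets \<mu>"
      using closed by (auto simp: sets_\<mu>)
    show "incseq (\<lambda>n. ?N (e / ratio ^ n))"
    proof (intro incseq_SucI Collect_mono impI)
      fix n x assume "infdist x K \<le> e / ratio ^ n"
      also have "\<dots> \<le> e / ratio ^ Suc n"
        using assms ratio by (intro divide_left_mono power_decreasing mult_pos_pos) auto
      finally show "infdist x K \<le> e / ratio ^ Suc n" .
    qed
  qed
  moreover have "(\<Union>n. ?N (e / ratio ^ n)) = UNIV"
  proof (intro set_eqI iffI UNIV_I)
    fix x
    have "0 < infdist x K + 1"
      using infdist_nonneg[of x K] by linarith
    then obtain n where "ratio ^ n < e / (infdist x K + 1)"
      using real_arch_pow_inv[OF _ ratio(2)] assms by (meson divide_pos_pos)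
    then have "infdist x K \<le> e / ratio ^ n"
      using ratio(1) \<open>0 < infdist x K + 1\<close> by (simp add: field_simps)
        (smt (verit) zero_less_power)
    then show "x \<in> (\<Union>n. ?N (e / ratio ^ n))"
      by blast
  qed
  ultimately have "1 \<le> measure \<mu> (?N e)"
    using le prob_space by (intro LIMSEQ_le_const2) (auto simp: space_\<mu>)
  then show ?thesis
    using prob_le_1 by (simp add: antisym)
qed

lemma prob_K: "measure \<mu> K = 1"
proof -
  \<comment> \<open>Any sequence that decreases to 0 through positive values would do.\<close>
  define \<delta> :: "nat \<Rightarrow> real" where "\<delta> n = (1 / 2) ^ n" for n
  have "(\<lambda>n. emeasure \<mu> {x. infdist x K \<le> \<delta> n}) \<longlonglongrightarrow> emeasure \<mu> K"
  proof (rule emeasure_closed_neighbourhoods_tendsto)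
    show "decseq \<delta>"
      unfolding \<delta>_def by (intro decseq_SucI) simp
    show "\<delta> \<longlonglongrightarrow> 0"
      unfolding \<delta>_def by (rule LIMSEQ_realpow_zero) auto
  qed (use finite_measure_axioms sets_\<mu> compact_K K_nonempty in \<open>auto intro: compact_imp_closed\<close>)
  moreover have "emeasure \<mu> {x. infdist x K \<le> \<delta> n} = 1" for n
    using measure_neighbourhood_K[of "\<delta> n"] by (simp add: emeasure_eq_measure \<delta>_def)
  ultimately have "emeasure \<mu> K = 1"
    using LIMSEQ_unique[OF tendsto_const] by fastforce
  then show ?thesis
    by (simp add: emeasure_eq_measure)
qed

lemma K_sets: "K \<in> sets \<mu>"
  by (simp add: sets_\<mu> borel_compact compact_K)

text \<open>
  In the self-similarity equation for \<open>S i ` A\<close> the terms with index \<open>j \<noteq> i\<close> vanish: by separation the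
  preimage under \<open>S j\<close> misses \<open>K\<close>, which carries all the mass.
\<close>

lemma measure_image_S:
  assumes i: "i \<in> {1..m}" and A: "compact A" "A \<subseteq> K"
  shows "measure \<mu> (S i ` A) = p i * measure \<mu> A"
proof -
  have SA: "S i ` A \<in> sets borel"
    using A(1) i by (intro borel_compact compact_continuous_image continuous_on_S)
  have "measure \<mu> (S j -` S i ` A) = of_bool (j = i) * measure \<mu> A" if j: "j \<in> {1..m}" for j
  proof (cases "j = i")
    case True
    then show ?thesis
      using inj_vimage_image_eq[OF inj_S[OF i]] by simp
  next
    case False
    then have "S i ` K \<inter> S j ` K = {}"
      using separation i j by (auto simp: strong_separation_def disjoint_family_on_def)
    then have "S j -` S i ` A \<subseteq> space \<mu> - K"
      using A(2) by (auto simp: space_\<mu>)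
    then have "measure \<mu> (S j -` S i ` A) \<le> measure \<mu> (space \<mu> - K)"
      using K_sets by (intro finite_measure_mono) auto
    also have "\<dots> = 0"
      using prob_compl[OF K_sets] prob_K by simp
    finally show ?thesis
      using False measure_le_0_iff by auto
  qed
  then have "measure \<mu> (S i ` A) = (\<Sum>j=1..m. p j * (of_bool (j = i) * measure \<mu> A))"
    unfolding measure_self_similar[OF SA] by (intro sum.cong) auto
  also have "\<dots> = (\<Sum>j=1..m. if j = i then p i * measure \<mu> A else 0)"
    by (intro sum.cong) auto
  also have "\<dots> = p i * measure \<mu> A"
    using i by simp
  finally show ?thesis .
qed

lemma measure_cube: "w \<in> lists {1..m} \<Longrightarrow> measure \<mu> (cube w) = prod_list (map p w)"
  by (induction w)
    (auto simp: cube_simps prob_K measure_image_S compact_cube cube_subset_K)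

lemma measure_cube_pos: "w \<in> lists {1..m} \<Longrightarrow> 0 < measure \<mu> (cube w)"
  unfolding measure_cube by (induction w) (auto simp: p_pos)

sublocale shrinking_cube_tree \<mu> "{1..m}" cube "ennreal weight" "\<lambda>n. ratio ^ n * diameter K"
proof
  show "countable {1..m}" "0 < ennreal weight" "ennreal weight < top" "sets \<mu> = sets borel"
    by (simp_all add: weight sets_\<mu>)
  show "\<exists>w\<in>lists {1..m}. length w = n \<and> x \<in> cube w" if "x \<in> cube []" for x n
    using that cubes_cover_K by (simp add: cube_simps)
  show "decseq (\<lambda>n. ratio ^ n * diameter K)"
    using ratio diameter_ge_0[OF compact_imp_bounded[OF compact_K]]
    by (intro decseq_SucI mult_right_mono power_decreasing) auto
  have "(\<lambda>n. ratio ^ n * diameter K) \<longlonglongrightarrow> 0 * diameter K"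
    using ratio by (intro tendsto_mult LIMSEQ_realpow_zero tendsto_const) auto
  then show "(\<lambda>n. ratio ^ n * diameter K) \<longlonglongrightarrow> 0" by simp
next
  fix w assume w: "w \<in> lists {1..m}"
  show "cube w \<in> sets \<mu>"
    using compact_cube[OF w] by (simp add: sets_\<mu> borel_compact)
  show "0 < emeasure \<mu> (cube w)"
    using measure_cube_pos[OF w] by (simp add: emeasure_eq_measure)
  fix i assume i: "i \<in> {1..m}"
  show "cube (w @ [i]) \<subseteq> cube w"
    using w i by (rule cube_append)
  have "weight * measure \<mu> (cube w) \<le> measure \<mu> (cube (w @ [i]))"
    using w i measure_cube_pos[OF w] weight(2)[OF i]
    by (simp add: measure_cube mult.commute[of _ "p i"] mult_right_mono)
  then show "ennreal weight * emeasure \<mu> (cube w) \<le> emeasure \<mu> (cube (w @ [i]))"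
    using weight(1) by (simp add: emeasure_eq_measure ennreal_mult[symmetric])
qed (use cubes_same_length_disjoint dist_cube_le in auto)

text \<open>
  A function that is measurable for the completion agrees almost everywhere with a Borel function. Apart
  from measurability, both sides of the equivalence, and also the maximal function at every single point, depend only on integrals over
  subsets of \<open>K\<close>, so \<open>\<bar>f\<bar>\<close> may be replaced by a Borel function \<open>h\<close> that vanishes outside \<open>K\<close>.
\<close>

lemma maximal_op_L1_iff_LlogL:
  assumes f: "integrable (measure_on K \<mu>) f"
  shows "L1_nonneg (measure_on K \<mu>) (maximal_op m S K \<mu> f) \<longleftrightarrow> f \<in> LlogL (measure_on K \<mu>)"
proof -
  have K_compl: "K \<inter> space (completion \<mu>) \<in> sets (completion \<mu>)"
    using K_sets by (simp add: space_\<mu>)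
  have nn: "(\<integral>\<^sup>+x. F x \<partial>measure_on K \<mu>) = (\<integral>\<^sup>+x\<in>K. F x \<partial>\<mu>)" for F
    unfolding measure_on_def nn_integral_restrict_space[OF K_compl] nn_integral_completion ..
  have "integrable (completion \<mu>) (\<lambda>x. indicator K x *\<^sub>R f x)"
    using f unfolding measure_on_def integrable_restrict_space[OF K_compl] .
  then obtain g where g [measurable]: "g \<in> borel_measurable \<mu>"
    and eq: "AE x in \<mu>. indicator K x *\<^sub>R f x = g x"
    using completion_ex_borel_measurable_real[OF borel_measurable_integrable] by blast
  note K_sets [measurable]
  define h where "h x = \<bar>g x\<bar> * indicator K x" for x
  have h [measurable]: "h \<in> borel_measurable \<mu>"
    unfolding h_def by measurable
  have h_eq: "AE x in \<mu>. x \<in> K \<longrightarrow> \<bar>f x\<bar> = h x"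
    using eq by eventually_elim (auto simp: h_def)
  have transfer: "(\<integral>\<^sup>+x\<in>A. F \<bar>f x\<bar> \<partial>\<mu>) = (\<integral>\<^sup>+x\<in>A. F (h x) \<partial>\<mu>)"
    if "A \<subseteq> K" for A and F :: "real \<Rightarrow> ennreal"
    using h_eq that by (intro nn_integral_cong_AE) (auto elim!: eventually_mono simp: indicator_def)
  have on_K: "(\<integral>\<^sup>+x\<in>K. F x \<partial>\<mu>) = (\<integral>\<^sup>+x. F x \<partial>\<mu>)" if "\<And>x. x \<notin> K \<Longrightarrow> F x = 0" for F
    using that by (intro nn_integral_cong) (auto simp: indicator_def)
  have L1: "(\<integral>\<^sup>+x. h x \<partial>\<mu>) < top"
  proof -
    have "(\<integral>\<^sup>+x. ennreal \<bar>f x\<bar> \<partial>measure_on K \<mu>) < top"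
      using f by (simp add: integrable_iff_bounded less_top[symmetric])
    then show ?thesis
      using transfer[of K ennreal] on_K[of "\<lambda>x. ennreal (h x)"] by (simp add: nn h_def)
  qed
  have max: "maximal_op m S K \<mu> f = maximal (\<lambda>x. ennreal (h x))"
  proof
    fix x
    have "(\<integral>\<^sup>+y\<in>cube w. ennreal \<bar>f y\<bar> \<partial>measure_on K \<mu>) / emeasure (measure_on K \<mu>) (cube w)
        = average (\<lambda>x. ennreal (h x)) w" if w: "w \<in> lists {1..m}" for w
    proof -
      have "(\<integral>\<^sup>+y\<in>cube w. ennreal \<bar>f y\<bar> \<partial>measure_on K \<mu>) = (\<integral>\<^sup>+y\<in>cube w. ennreal \<bar>f y\<bar> \<partial>\<mu>)"
        unfolding nn using cube_subset_K[OF w]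
        by (intro nn_integral_cong) (auto simp: indicator_def)
      moreover have "emeasure (measure_on K \<mu>) (cube w) = emeasure \<mu> (cube w)"
        unfolding measure_on_def using emeasure_restrict_space[OF K_compl cube_subset_K[OF w]] sets_cube[OF w]
        by simp
      ultimately show ?thesis
        using transfer[OF cube_subset_K[OF w], of ennreal] by (simp add: average_def)
    qed
    moreover have "{w. (\<exists>n\<ge>1. w \<in> words m n) \<and> x \<in> cube w} =
        {w \<in> lists {1..m}. w \<noteq> [] \<and> x \<in> cube w}"
      by (auto simp: words_def in_lists_conv_set Suc_le_eq)
    ultimately show "maximal_op m S K \<mu> f x = maximal (\<lambda>x. ennreal (h x)) x"
      unfolding maximal_op_def maximal_def by (intro SUP_cong) auto
  qed
  have max_outside: "maximal (\<lambda>x. ennreal (h x)) x = 0" if "x \<notin> K" for x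
  proof -
    have "{w \<in> lists {1..m}. w \<noteq> [] \<and> x \<in> cube w} = {}"
      using that cube_subset_K by blast
    then show ?thesis
      unfolding maximal_def by (simp only: image_empty Sup_empty bot_ennreal)
  qed
  have "L1_nonneg (measure_on K \<mu>) (maximal_op m S K \<mu> f) \<longleftrightarrow>
      (\<integral>\<^sup>+x. maximal (\<lambda>x. ennreal (h x)) x \<partial>\<mu>) < top"
  proof -
    have "maximal (\<lambda>x. ennreal (h x)) \<in> borel_measurable (measure_on K \<mu>)"
      unfolding measure_on_def
      by (intro measurable_restrict_space1 measurable_completion borel_measurable_maximal)
    then show ?thesis
      using on_K[of "maximal (\<lambda>x. ennreal (h x))", OF max_outside] by (simp add: L1_nonneg_def max nn)
  qed
  also have "\<dots> \<longleftrightarrow> (\<integral>\<^sup>+x. ennreal (h x * log_plus (h x)) \<partial>\<mu>) < top"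
    by (rule maximal_integrable_iff_LlogL[OF h _ _ L1]) (simp_all add: h_def cube_simps)
  also have "\<dots> \<longleftrightarrow> f \<in> LlogL (measure_on K \<mu>)"
    using borel_measurable_integrable[OF f] transfer[of K "\<lambda>t. ennreal (t * log_plus t)"]
      on_K[of "\<lambda>x. ennreal (h x * log_plus (h x))"]
    by (simp add: LlogL_def nn h_def)
  finally show ?thesis .
qed

end

theorem theorem1p8:
  fixes m :: nat
    and r p :: "nat \<Rightarrow> real"
    and R :: "nat \<Rightarrow> real ^ 'd \<Rightarrow> real ^ 'd"
    and b :: "nat \<Rightarrow> real ^ 'd"
    and K :: "(real ^ 'd) set"
    and \<mu> :: "(real ^ 'd) measure"
    and f :: "real ^ 'd \<Rightarrow> real"
  assumes "similarity_system m r R b"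
    and "self_similar_set m (sim_map r R b) K"
    and "probability_vector m p"
    and "self_similar_measure m (sim_map r R b) p \<mu>"
    and "strong_separation m (sim_map r R b) K"
    and "integrable (measure_on K \<mu>) f"
  shows "L1_nonneg (measure_on K \<mu>) (maximal_op m (sim_map r R b) K \<mu> f)
    \<longleftrightarrow> f \<in> LlogL (measure_on K \<mu>)"
proof -
  interpret separated_self_similar m r p R b K \<mu>
    using assms(1-5) by unfold_locales
  show ?thesis
    using assms(6) by (rule maximal_op_L1_iff_LlogL)
qed

end
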